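(* Let $1\le k\le n$, let $I=\{i_1<\dots<i_k\}\subset\{1,\dots,n\}$ and let $\ell(I)=\sum_{a=1}^k(i_a-a)$. Considering the weight function $W_I$ as a polynomial in $h$, we have $$W_I=\mathrm{sgn}(I)\,\Delta_I(t,z)\cdot h^{k^2+\ell(I)}+\text{terms of lower degree in } h.$$
   Context: $z_1,\dots,z_n,h,t_1,\dots,t_k$ are variables. $\mathrm{sgn}(I)=(-1)^{k(n-k)-\ell(I)}$. For a function $f$ of $t_1,\dots,t_k$, $\mathrm{Sym}_{S_k}f=\sum_{\sigma\in S_k}f(t_{\sigma(1)},\dots,t_{\sigma(k)})$. The weight function is the polynomial $$W_I(t_1,\dots,t_k)=h^k\,\mathrm{Sym}_{S_k}\Big(\prod_{a=1}^k\Big(\prod_{u=1}^{i_a-1}(t_a-z_u+h)\prod_{u=i_a+1}^n(t_a-z_u)\prod_{b=a+1}^k\frac{t_a-t_b+h}{t_a-t_b}\Big)\Big).$$ The double Schur polynomial is $$\Delta_I(t_1,\dots,t_k,z_1,\dots,z_n)=(-1)^{k(n-k)-\ell(I)}\det\Big(\prod_{u=i_\alpha+1}^n(t_\beta-z_u)\Big)_{\alpha,\beta=1,\dots,k}\cdot\frac1{\prod_{1\le a<b\le k}(t_a-t_b)}.$$ *)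

theory Defs
  imports
    "HOL-Library.Poly_Mapping"
    "HOL-Computational_Algebra.Polynomial_Factorial"
    "HOL-Combinatorics.Permutations"
    "Jordan_Normal_Form.Determinant"
begin

text \<open>
  Polynomials in the \<open>z\<close>-variables over \<open>'a\<close>, and polynomials in the \<open>t\<close>-variables with
  coefficients in those. A monomial is a finitely supported exponent function, so \<open>'a tzpoly\<close> is
  the ring \<open>'a[z][t]\<close>. The polynomial ring \<open>'a[z][t][h]\<close> is \<open>'a tzpoly poly\<close>, and \<open>'a ratfun\<close>
  is its fraction field, the field of rational functions in all the variables.
\<close>

type_synonym 'a zpoly = "(nat \<Rightarrow>\<^sub>0 nat) \<Rightarrow>\<^sub>0 'a"
type_synonym 'a tzpoly = "(nat \<Rightarrow>\<^sub>0 nat) \<Rightarrow>\<^sub>0 'a zpoly"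
type_synonym 'a ratfun = "'a tzpoly poly fract"

definition zvar :: "nat \<Rightarrow> 'a::idom ratfun" where
  "zvar u = to_fract [:Poly_Mapping.single 0 (Poly_Mapping.single (Poly_Mapping.single u 1) 1):]"

definition tvar :: "nat \<Rightarrow> 'a::idom ratfun" where
  "tvar a = to_fract [:Poly_Mapping.single (Poly_Mapping.single a 1) 1:]"

definition hvar :: "'a::idom ratfun" where
  "hvar = to_fract [:0, 1:]"

text \<open>The elements \<open>i\<^sub>1 < \<dots> < i\<^sub>k\<close> of a finite set, numbered from 1.\<close>

definition elt :: "nat set \<Rightarrow> nat \<Rightarrow> nat" where
  "elt I a = sorted_list_of_set I ! (a - 1)"

definition ell :: "nat \<Rightarrow> nat set \<Rightarrow> nat" where
  "ell k I = (\<Sum>a=1..k. elt I a - a)"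

text \<open>
  For a \<open>k\<close>-element subset of \<open>{1..n}\<close> we have \<open>a \<le> i\<^sub>a \<le> n - k + a\<close>, so none of the
  subtractions on \<^typ>\<open>nat\<close> here and in \<^const>\<open>ell\<close> is truncated.
\<close>

definition sgnI :: "nat \<Rightarrow> nat \<Rightarrow> nat set \<Rightarrow> 'a::comm_ring_1" where
  "sgnI n k I = (-1) ^ (k * (n - k) - ell k I)"

definition Sym :: "nat \<Rightarrow> ((nat \<Rightarrow> 'b) \<Rightarrow> 'c::comm_monoid_add) \<Rightarrow> (nat \<Rightarrow> 'b) \<Rightarrow> 'c" where
  "Sym k f t = (\<Sum>\<sigma> | \<sigma> permutes {1..k}. f (\<lambda>a. t (\<sigma> a)))"

definition weight_function :: "nat \<Rightarrow> nat \<Rightarrow> nat set \<Rightarrow> 'a::idom ratfun" where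
  "weight_function n k I =
     hvar ^ k * Sym k (\<lambda>t. \<Prod>a=1..k.
         (\<Prod>u=1..elt I a - 1. t a - zvar u + hvar) *
         (\<Prod>u=elt I a + 1..n. t a - zvar u) *
         (\<Prod>b=a+1..k. (t a - t b + hvar) / (t a - t b))) tvar"

text \<open>Matrices are indexed from 0, whence the shifts in the determinant.\<close>

definition double_schur :: "nat \<Rightarrow> nat \<Rightarrow> nat set \<Rightarrow> 'a::idom ratfun" where
  "double_schur n k I =
     (-1) ^ (k * (n - k) - ell k I) *
     det (mat k k (\<lambda>(\<alpha>, \<beta>). \<Prod>u=elt I (\<alpha> + 1) + 1..n. tvar (\<beta> + 1) - zvar u)) *
     (1 / (\<Prod>a=1..k. \<Prod>b=a+1..k. tvar a - tvar b))"

end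

theory Submission
  imports Defs
begin

text \<open>
  Bringing the summands of \<open>W\<^sub>I\<close> to the common denominator \<open>V = \<Prod>\<^bsub>a<b\<^esub> (t\<^sub>a - t\<^sub>b)\<close> turns the
  symmetrization into an alternating sum \<open>N\<close> of polynomials, so that \<open>W\<^sub>I = N / V\<close>. An alternating
  sum vanishes whenever \<open>t\<^sub>a = t\<^sub>b\<close>, hence is divisible by \<open>V\<close>, and \<open>W\<^sub>I\<close> is a polynomial. Since
  \<open>V\<close> is free of \<open>h\<close>, the top coefficient in \<open>h\<close> of \<open>W\<^sub>I\<close> is that of \<open>N\<close> divided by \<open>V\<close>, and the top
  coefficient of \<open>N\<close> is the Leibniz expansion of the determinant in \<open>\<Delta>\<^sub>I\<close>.

  Divisibility is proved for polynomial functions over an infinite integral domain, which are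
  specialized to the variables only at the end.
\<close>

section \<open>Degrees and top coefficients of products\<close>

text \<open>Upper bounds can replace exact degrees: if one of them is strict, both sides of the
  coefficient identity are 0. No leading coefficient has to be shown nonzero.\<close>

lemma coeff_mult_degree_le:
  fixes p q :: "'a::comm_semiring_0 poly"
  assumes "degree p \<le> m" "degree q \<le> n"
  shows "degree (p * q) \<le> m + n" "coeff (p * q) (m + n) = coeff p m * coeff q n"
proof -
  show "degree (p * q) \<le> m + n"
    using degree_mult_le[of p q] assms by linarith
  show "coeff (p * q) (m + n) = coeff p m * coeff q n"
  proof (cases "degree p = m \<and> degree q = n")
    case True
    then show ?thesis using coeff_mult_degree_sum[of p q] by simp
  next
    case False
    then have "degree p < m \<or> degree q < n" using assms by auto
    moreover from this have "degree (p * q) < m + n"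
      using degree_mult_le[of p q] assms by linarith
    ultimately show ?thesis by (auto simp: coeff_eq_0)
  qed
qed

lemma coeff_prod_degree_le:
  fixes f :: "'i \<Rightarrow> 'a::comm_semiring_1 poly"
  assumes "finite A" "\<And>i. i \<in> A \<Longrightarrow> degree (f i) \<le> d i"
  shows "degree (\<Prod>i\<in>A. f i) \<le> (\<Sum>i\<in>A. d i) \<and>
    coeff (\<Prod>i\<in>A. f i) (\<Sum>i\<in>A. d i) = (\<Prod>i\<in>A. coeff (f i) (d i))"
  using assms by (induction) (auto simp: coeff_mult_degree_le)

lemma to_fract_prod: "to_fract (\<Prod>i\<in>A. f i) = (\<Prod>i\<in>A. to_fract (f i))"
  by (induction A rule: infinite_finite_induct) auto

lemma to_fract_of_int: "to_fract (of_int m) = of_int m"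
proof -
  have "to_fract (of_nat i) = of_nat i" for i
    by (induction i) auto
  then show ?thesis by (cases m rule: int_cases2) auto
qed

section \<open>The Vandermonde product under permutations\<close>

definition vandermonde :: "nat \<Rightarrow> (nat \<Rightarrow> 'a::comm_ring_1) \<Rightarrow> 'a" where
  "vandermonde k x = (\<Prod>a=1..k. \<Prod>b=a+1..k. x a - x b)"

text \<open>A single flat index set, so that inversions can be counted in it and linear factors
  split off one at a time by induction on its subsets.\<close>

definition pairs :: "nat \<Rightarrow> (nat \<times> nat) set" where
  "pairs k = (SIGMA a:{1..k}. {a+1..k})"

lemma finite_pairs [simp]: "finite (pairs k)"
  by (simp add: pairs_def)

lemma mem_pairs [simp]: "(a, b) \<in> pairs k \<longleftrightarrow> 1 \<le> a \<and> a < b \<and> b \<le> k"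
  by (auto simp: pairs_def)

lemma vandermonde_pairs: "vandermonde k x = (\<Prod>(a, b)\<in>pairs k. x a - x b)"
  by (simp add: vandermonde_def pairs_def prod.Sigma)

text \<open>The inverted pairs are \<open>(a, b)\<close> itself and, for each \<open>c\<close>
  strictly between, both \<open>(a, c)\<close> and \<open>(c, b)\<close>.\<close>

lemma card_transpose_inversions:
  assumes "1 \<le> a" "a < b" "b \<le> k"
  shows "odd (card {(i, j) \<in> pairs k. transpose a b j < transpose a b i})"
proof -
  let ?M = "{a<..<b}"
  have "{(i, j) \<in> pairs k. transpose a b j < transpose a b i} =
      insert (a, b) (({a} \<times> ?M) \<union> (?M \<times> {b}))"
    using assms by (auto simp: transpose_def split: if_splits)
  moreover have "card (({a} \<times> ?M) \<union> (?M \<times> {b})) = card ?M + card ?M"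
    by (subst card_Un_disjoint) (auto simp: card_cartesian_product)
  ultimately show ?thesis by simp
qed

text \<open>A permutation rearranges the unordered pairs of indices, and the factor of a pair
  changes sign exactly when the pair is inverted.\<close>

lemma vandermonde_permute_inversions:
  fixes x :: "nat \<Rightarrow> 'a::comm_ring_1"
  assumes "\<sigma> permutes {1..k}"
  shows "vandermonde k (x \<circ> \<sigma>) =
    (-1) ^ card {(i, j) \<in> pairs k. \<sigma> j < \<sigma> i} * vandermonde k x"
proof -
  let ?i = "inv_into UNIV \<sigma>"
  \<comment> \<open>\<open>?e\<close> is the sign picked up by a pair, \<open>?s\<close> maps a pair
    to its image in increasing order, and \<open>?r\<close> does the same for the inverse
    permutation, so that \<open>?r\<close> undoes \<open>?s\<close>.\<close>
  let ?e = "\<lambda>i j. if \<sigma> j < \<sigma> i then -1 else 1 :: 'a"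
  let ?s = "\<lambda>(i, j). if \<sigma> j < \<sigma> i then (\<sigma> j, \<sigma> i) else (\<sigma> i, \<sigma> j)"
  let ?r = "\<lambda>(i, j). if ?i j < ?i i then (?i j, ?i i) else (?i i, ?i j)"
  have inj: "\<sigma> i = \<sigma> j \<longleftrightarrow> i = j" for i j
    using permutes_inj[OF assms] by (auto dest: injD)
  have inj': "?i i = ?i j \<longleftrightarrow> i = j" for i j
    using permutes_inj[OF permutes_inv[OF assms]] by (auto dest: injD)
  have mem: "\<sigma> i \<in> {1..k} \<longleftrightarrow> i \<in> {1..k}" "?i i \<in> {1..k} \<longleftrightarrow> i \<in> {1..k}" for i
    using permutes_in_image[OF assms] permutes_in_image[OF permutes_inv[OF assms]] by auto
  have "vandermonde k (x \<circ> \<sigma>) =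
      (\<Prod>(i, j)\<in>pairs k. ?e i j * (case ?s (i, j) of (a, b) \<Rightarrow> x a - x b))"
    unfolding vandermonde_pairs by (intro prod.cong) (auto split: prod.splits)
  also have "\<dots> = (\<Prod>(i, j)\<in>pairs k. ?e i j) * (\<Prod>p\<in>pairs k. case ?s p of (a, b) \<Rightarrow> x a - x b)"
    unfolding prod.distrib[symmetric] by (intro prod.cong) auto
  also have "(\<Prod>p\<in>pairs k. case ?s p of (a, b) \<Rightarrow> x a - x b) = vandermonde k x"
    unfolding vandermonde_pairs
  proof (rule prod.reindex_bij_witness[of _ ?r ?s])
    fix p assume "p \<in> pairs k"
    then obtain i j where p: "p = (i, j)" "1 \<le> i" "i < j" "j \<le> k"
      by (cases p) auto
    have k: "\<sigma> i \<in> {1..k}" "\<sigma> j \<in> {1..k}" "?i i \<in> {1..k}" "?i j \<in> {1..k}"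
      using p mem by auto
    show "?r (?s p) = p" "?s (?r p) = p"
      using p by (auto simp: permutes_inverses[OF assms])
    show "?s p \<in> pairs k" "?r p \<in> pairs k"
      using p k inj[of i j] inj'[of i j] by (auto simp: linorder_not_less order.order_iff_strict)
  qed auto
  also have "(\<Prod>(i, j)\<in>pairs k. ?e i j) = (-1) ^ card {(i, j) \<in> pairs k. \<sigma> j < \<sigma> i}"
  proof -
    have "{(i, j) \<in> pairs k. \<sigma> j < \<sigma> i} = pairs k \<inter> {p. \<sigma> (snd p) < \<sigma> (fst p)}"
      by auto
    then show ?thesis by (simp add: case_prod_unfold prod.If_cases)
  qed
  finally show ?thesis .
qed

text \<open>Inversions are counted only for transpositions, where their number is odd. Any other
  permutation is composed of transpositions, each of which flips both signs.\<close>

lemma vandermonde_permute: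
  fixes x :: "nat \<Rightarrow> 'a::comm_ring_1"
  assumes "\<sigma> permutes {1..k}"
  shows "vandermonde k (x \<circ> \<sigma>) = of_int (sign \<sigma>) * vandermonde k x"
proof -
  have *: "vandermonde k (x \<circ> transpose a b) = - vandermonde k x"
    if "a \<in> {1..k}" "b \<in> {1..k}" "a \<noteq> b" for a b and x :: "nat \<Rightarrow> 'a"
    using that
  proof (induction a b rule: linorder_wlog)
    case (le a b)
    then show ?case
      using card_transpose_inversions[of a b k] 
        vandermonde_permute_inversions[OF permutes_swap_id[of a "{1..k}" b], of x]
      by (auto simp: o_def simp del: mem_pairs)
  next
    case (sym a b)
    then show ?case by (simp add: transpose_commute)
  qed
  show ?thesis
    using finite_atLeastAtMost assms
  proof (induction arbitrary: x rule: permutes_rev_induct)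
    case id
    then show ?case by simp
  next
    case (swap a b p)
    have "sign (p \<circ> transpose a b) = - sign p"
      using swap.hyps by (subst sign_compose)
        (auto simp: sign_swap_id permutation_swap_id intro: permutes_imp_permutation)
    moreover have "vandermonde k (x \<circ> (p \<circ> transpose a b)) = - vandermonde k (x \<circ> p)"
      using *[OF swap.hyps(1-3), of "x \<circ> p"] by (simp only: o_assoc)
    ultimately show ?case using swap.IH by (simp del: o_apply)
  qed
qed

section \<open>Polynomial functions in several variables\<close>

text \<open>With functions in place of formal polynomials, setting one variable equal to another is
  a mere function update.\<close>

inductive polyfun :: "((nat \<Rightarrow> 'a::comm_ring_1) \<Rightarrow> 'a) \<Rightarrow> bool" where
  const: "polyfun (\<lambda>x. c)"
| proj: "polyfun (\<lambda>x. x i)"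
| add: "polyfun f \<Longrightarrow> polyfun g \<Longrightarrow> polyfun (\<lambda>x. f x + g x)"
| mult: "polyfun f \<Longrightarrow> polyfun g \<Longrightarrow> polyfun (\<lambda>x. f x * g x)"

lemma polyfun_diff: "polyfun f \<Longrightarrow> polyfun g \<Longrightarrow> polyfun (\<lambda>x. f x - g x)"
  using polyfun.add[OF _ polyfun.mult[OF polyfun.const[of "-1"]], of f g] by simp

lemma polyfun_sum:
  assumes "\<And>i. i \<in> A \<Longrightarrow> polyfun (f i)"
  shows "polyfun (\<lambda>x. \<Sum>i\<in>A. f i x)"
  using assms by (induction A rule: infinite_finite_induct) (auto intro: polyfun.intros)

lemma polyfun_prod:
  assumes "\<And>i. i \<in> A \<Longrightarrow> polyfun (f i)"
  shows "polyfun (\<lambda>x. \<Prod>i\<in>A. f i x)"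
  using assms by (induction A rule: infinite_finite_induct) (auto intro: polyfun.intros)

lemma polyfun_compose:
  assumes "polyfun f" "\<And>i. polyfun (\<lambda>x. g x i)"
  shows "polyfun (\<lambda>x. f (g x))"
  using assms(1) by induction (auto intro: polyfun.intros assms(2))

text \<open>Induction with the product rule for differences: writing f' for f after the
  substitution, f1 f2 - f1' f2' = (f1 - f1') f2 + f1' (f2 - f2').\<close>

lemma polyfun_divided_difference:
  assumes "polyfun f"
  shows "\<exists>g. polyfun g \<and> (\<forall>x. f x - f (x(a := x b)) = (x a - x b) * g x)"
  using assms
proof induction
  case (const c)
  show ?case by (intro exI[of _ "\<lambda>x. 0"]) (auto intro: polyfun.intros)
next
  case (proj i)
  show ?case by (intro exI[of _ "\<lambda>x. if i = a then 1 else 0"]) (auto intro: polyfun.intros)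
next
  case (add f1 f2)
  then obtain g1 g2 where g: "polyfun g1" "polyfun g2"
    and e: "\<And>x. f1 x - f1 (x(a := x b)) = (x a - x b) * g1 x"
      "\<And>x. f2 x - f2 (x(a := x b)) = (x a - x b) * g2 x" by blast
  have "f1 x + f2 x - (f1 (x(a := x b)) + f2 (x(a := x b))) = (x a - x b) * (g1 x + g2 x)" for x
    by (simp add: distrib_left e[symmetric])
  then show ?case using g polyfun.add by blast
next
  case (mult f1 f2)
  then obtain g1 g2 where g: "polyfun g1" "polyfun g2"
    and e: "\<And>x. f1 x - f1 (x(a := x b)) = (x a - x b) * g1 x"
      "\<And>x. f2 x - f2 (x(a := x b)) = (x a - x b) * g2 x" by blast
  let ?g = "\<lambda>x. g1 x * f2 x + f1 (x(a := x b)) * g2 x"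
  have "polyfun (\<lambda>x. f1 (x(a := x b)))"
  proof (rule polyfun_compose[OF mult.hyps(1)])
    show "polyfun (\<lambda>x. (x(a := x b)) i)" for i
      by (cases "i = a") (auto intro: polyfun.intros)
  qed
  then have "polyfun ?g" using g mult.hyps by (intro polyfun.intros)
  moreover have "f1 x * f2 x - f1 (x(a := x b)) * f2 (x(a := x b)) = (x a - x b) * ?g x" for x
  proof -
    have "f1 x * f2 x - f1 (x(a := x b)) * f2 (x(a := x b)) =
        (f1 x - f1 (x(a := x b))) * f2 x + f1 (x(a := x b)) * (f2 x - f2 (x(a := x b)))"
      by (simp add: algebra_simps)
    then show ?thesis unfolding e by (simp add: algebra_simps)
  qed
  ultimately show ?case by blast
qed

text \<open>The line passes through \<open>x\<close> at \<open>s = 0\<close> and through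
  \<open>y\<close> at \<open>s = 1\<close>; on it, identities reduce to counting the roots of a
  univariate polynomial.\<close>

lemma polyfun_line:
  assumes "polyfun f"
  shows "\<exists>p. \<forall>s. poly p s = f (\<lambda>i. x i + s * (y i - x i))"
  using assms
proof induction
  case (const c)
  show ?case by (intro exI[of _ "[:c:]"]) auto
next
  case (proj i)
  show ?case by (intro exI[of _ "[:x i, y i - x i:]"]) auto
next
  case (add f g)
  then obtain p q where "\<forall>s. poly p s = f (\<lambda>i. x i + s * (y i - x i))"
    "\<forall>s. poly q s = g (\<lambda>i. x i + s * (y i - x i))" by blast
  then show ?case by (intro exI[of _ "p + q"]) simp
next
  case (mult f g)
  then obtain p q where "\<forall>s. poly p s = f (\<lambda>i. x i + s * (y i - x i))"
    "\<forall>s. poly q s = g (\<lambda>i. x i + s * (y i - x i))" by blast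
  then show ?case by (intro exI[of _ "p * q"]) simp
qed

text \<open>
  Restricted to the line through \<open>x\<close> and \<open>y\<close>, both factors are univariate polynomials.
\<close>

lemma polyfun_mult_eq_0:
  fixes f g :: "(nat \<Rightarrow> 'a::idom) \<Rightarrow> 'a"
  assumes inf: "infinite (UNIV :: 'a set)" and "polyfun f" "polyfun g"
    and fg: "\<And>x. f x * g x = 0" and fy: "f y \<noteq> 0"
  shows "g x = 0"
proof -
  obtain p where p: "\<And>s. poly p s = f (\<lambda>i. x i + s * (y i - x i))"
    using polyfun_line[OF assms(2), of x y] by blast
  obtain q where q: "\<And>s. poly q s = g (\<lambda>i. x i + s * (y i - x i))"
    using polyfun_line[OF assms(3), of x y] by blast
  have "{s. poly (p * q) s = 0} = UNIV" by (simp add: p q fg)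
  then have "p * q = 0" using poly_roots_finite[of "p * q"] inf by auto
  moreover have "p \<noteq> 0" using p[of 1] fy by auto
  ultimately have "q = 0" by simp
  then show ?thesis using q[of 0] by simp
qed

section \<open>Divisibility of alternating sums by the Vandermonde product\<close>

text \<open>Linear factors are split off one by one. Suppose f = v g with v the product over the
  pairs treated so far, and let \<open>(a, b)\<close> be a new pair. Setting \<open>x a\<close> to
  \<open>x b\<close> kills f but not v identically, so it kills g, and the divided difference of g
  supplies the factor \<open>x a - x b\<close>.\<close>

lemma vandermonde_dvd:
  fixes f :: "(nat \<Rightarrow> 'a::idom) \<Rightarrow> 'a"
  assumes inf: "infinite (UNIV :: 'a set)" and f: "polyfun f"
    and vanish: "\<And>a b x. (a, b) \<in> pairs k \<Longrightarrow> x a = x b \<Longrightarrow> f x = 0"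
  shows "\<exists>g. polyfun g \<and> (\<forall>x. f x = vandermonde k x * g x)"
proof -
  have "\<exists>g. polyfun g \<and> (\<forall>x. f x = (\<Prod>(a, b)\<in>S. x a - x b) * g x)" if "S \<subseteq> pairs k" for S
    using finite_subset[OF that finite_pairs] that
  proof (induction S rule: finite_induct)
    case empty
    then show ?case using f by auto
  next
    case (insert ab S)
    obtain a b where ab: "ab = (a, b)" by (cases ab)
    with insert.prems have "a < b" and in_pairs: "(a, b) \<in> pairs k" by auto
    from insert obtain g where g: "polyfun g"
      and fg: "\<And>x. f x = (\<Prod>(a, b)\<in>S. x a - x b) * g x" by auto
    let ?r = "\<lambda>x :: nat \<Rightarrow> 'a. x(a := x b)"
    let ?v = "\<lambda>x :: nat \<Rightarrow> 'a. \<Prod>(c, d)\<in>S. ?r x c - ?r x d"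
    have r: "polyfun (\<lambda>x. ?r x i)" for i :: nat
      by (cases "i = a") (auto intro: polyfun.intros)
    \<comment> \<open>At a point with distinct coordinates, replacing \<open>y a\<close> by
      \<open>y b\<close> makes only the coordinates \<open>a\<close> and \<open>b\<close> coincide.
      The pair \<open>(a, b)\<close> is not in \<open>S\<close>, and \<open>(b, a)\<close> is
      excluded by the ordering of pairs.\<close>
    obtain y :: "nat \<Rightarrow> 'a" where y: "inj y"
      using infinite_countable_subset[OF inf] by blast
    have "?v y \<noteq> 0"
    proof -
      have "?r y c - ?r y d \<noteq> 0" if "(c, d) \<in> S" for c d
      proof -
        have "c < d" "(c, d) \<noteq> (a, b)" using that insert.prems insert.hyps ab by auto
        then show ?thesis using \<open>a < b\<close> inj_eq[OF y] by (auto simp: fun_upd_def)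
      qed
      then show ?thesis using insert.hyps by (auto simp: prod_zero_iff)
    qed
    moreover have "polyfun ?v"
      unfolding case_prod_unfold by (intro polyfun_prod polyfun_diff r)
    moreover have "polyfun (\<lambda>x. g (?r x))" by (intro polyfun_compose[OF g] r)
    moreover have "?v x * g (?r x) = 0" for x
      using vanish[OF in_pairs, of "?r x"] fg[of "?r x"] \<open>a < b\<close> by simp
    ultimately have g0: "g (?r x) = 0" for x
      by (rule polyfun_mult_eq_0[OF inf, rotated 3])
    obtain q where q: "polyfun q" "\<And>x. g x - g (?r x) = (x a - x b) * q x"
      using polyfun_divided_difference[OF g] by blast
    have "f x = (\<Prod>(a, b)\<in>insert ab S. x a - x b) * q x" for x
      using fg[of x] q(2)[of x] g0[of x] insert.hyps by (simp add: ab mult_ac)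
    then show ?case using q(1) by blast
  qed
  then show ?thesis unfolding vandermonde_pairs by blast
qed

text \<open>
  The even and the odd permutations are paired off by a transposition, since in characteristic 2
  being equal to its own negative does not make the sum vanish.
\<close>

lemma alternating_sum_eq_0:
  fixes f :: "('i \<Rightarrow> 'b) \<Rightarrow> 'a::comm_ring_1"
  assumes "finite S" "a \<in> S" "b \<in> S" "a \<noteq> b" "x a = x b"
  shows "(\<Sum>\<sigma> | \<sigma> permutes S. of_int (sign \<sigma>) * f (x \<circ> \<sigma>)) = 0"
proof -
  let ?\<tau> = "transpose a b"
  let ?E = "{\<sigma>. \<sigma> permutes S \<and> evenperm \<sigma>}" and ?O = "{\<sigma>. \<sigma> permutes S \<and> \<not> evenperm \<sigma>}"
  have fin: "finite {\<sigma>. \<sigma> permutes S}" using assms(1) by (rule finite_permutations)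
  have \<tau>: "?\<tau> permutes S" using assms by (intro permutes_swap_id)
  have x: "x \<circ> (?\<tau> \<circ> \<sigma>) = x \<circ> \<sigma>" for \<sigma> :: "'i \<Rightarrow> 'i"
    using assms(5) by (auto simp: fun_eq_iff transpose_def)
  have \<tau>\<tau>: "?\<tau> \<circ> (?\<tau> \<circ> \<sigma>) = \<sigma>" for \<sigma> :: "'i \<Rightarrow> 'i"
    by (simp add: fun_eq_iff)
  have ev: "evenperm (?\<tau> \<circ> \<sigma>) \<longleftrightarrow> \<not> evenperm \<sigma>" if "\<sigma> permutes S" for \<sigma>
    using evenperm_comp[OF permutation_swap_id permutes_imp_permutation[OF assms(1) that], of a b]
      assms(4) by (simp add: evenperm_swap)
  have "(\<Sum>\<sigma> | \<sigma> permutes S. of_int (sign \<sigma>) * f (x \<circ> \<sigma>)) =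
      (\<Sum>\<sigma>\<in>?E. of_int (sign \<sigma>) * f (x \<circ> \<sigma>)) + (\<Sum>\<sigma>\<in>?O. of_int (sign \<sigma>) * f (x \<circ> \<sigma>))"
    by (subst sum.union_disjoint[symmetric]) (auto intro: finite_subset[OF _ fin] sum.cong)
  also have "\<dots> = (\<Sum>\<sigma>\<in>?E. f (x \<circ> \<sigma>)) - (\<Sum>\<sigma>\<in>?O. f (x \<circ> \<sigma>))"
    by (simp add: sign_def sum_negf)
  also have "(\<Sum>\<sigma>\<in>?E. f (x \<circ> \<sigma>)) = (\<Sum>\<sigma>\<in>?O. f (x \<circ> \<sigma>))"
    by (rule sum.reindex_bij_witness[of _ "(\<circ>) ?\<tau>" "(\<circ>) ?\<tau>"])
      (auto simp: x ev \<tau>\<tau> intro: permutes_compose[OF _ \<tau>])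
  finally show ?thesis by (simp del: o_apply)
qed

text \<open>When the domain is itself a polynomial ring, evaluating at the point whose coordinates
  are the variables turns this factorization of functions into one of polynomials.\<close>

lemma alternating_sum_factor:
  fixes f :: "(nat \<Rightarrow> 'a::idom) \<Rightarrow> 'a"
  assumes inf: "infinite (UNIV :: 'a set)" and f: "polyfun f"
  shows "\<exists>g. \<forall>x. (\<Sum>\<sigma> | \<sigma> permutes {1..k}. of_int (sign \<sigma>) * f (x \<circ> \<sigma>)) = vandermonde k x * g x"
proof -
  have "polyfun (\<lambda>x. f (x \<circ> \<sigma>))" for \<sigma>
    by (rule polyfun_compose[OF f]) (auto intro: polyfun.intros)
  then have "polyfun (\<lambda>x. \<Sum>\<sigma> | \<sigma> permutes {1..k}. of_int (sign \<sigma>) * f (x \<circ> \<sigma>))"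
    by (intro polyfun_sum polyfun.intros)
  moreover have "(\<Sum>\<sigma> | \<sigma> permutes {1..k}. of_int (sign \<sigma>) * f (x \<circ> \<sigma>)) = 0"
    if "(a, b) \<in> pairs k" "x a = x b" for a b x
    using that by (intro alternating_sum_eq_0[of _ a b]) auto
  ultimately show ?thesis using vandermonde_dvd[OF inf] by blast
qed

section \<open>Leibniz expansion, index bounds and the top coefficient of one summand\<close>

text \<open>Conjugating by the shift \<open>Suc\<close> matches permutations of
  \<open>{0..<k}\<close> with those of \<open>{1..k}\<close> and preserves the sign.\<close>

lemma det_mat_Suc:
  "det (mat k k (\<lambda>(\<alpha>, \<beta>). f (\<alpha> + 1) (\<beta> + 1))) =
    (\<Sum>\<sigma> | \<sigma> permutes {1..k}. of_int (sign \<sigma>) * (\<Prod>a=1..k. f a (\<sigma> a)))"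
proof -
  let ?m = "map_permutation {0..<k} Suc"
  let ?m' = "map_permutation {1..k} (\<lambda>i. i - 1)"
  have bij: "bij_betw Suc {0..<k} {1..k}"
    by (auto simp: bij_betw_def image_Suc_atLeastLessThan atLeastLessThanSuc_atLeastAtMost)
  have bij': "bij_betw (\<lambda>i. i - 1) {1..k} {0..<k}"
    by (rule bij_betwI[of _ _ _ Suc]) auto
  have "(\<Sum>\<sigma> | \<sigma> permutes {1..k}. of_int (sign \<sigma>) * (\<Prod>a=1..k. f a (\<sigma> a))) =
      (\<Sum>p | p permutes {0..<k}. of_int (sign p) * (\<Prod>i=0..<k. f (Suc i) (Suc (p i))))"
  proof (rule sum.reindex_bij_witness[of _ ?m ?m'])
    fix \<sigma> assume "\<sigma> \<in> {\<sigma>. \<sigma> permutes {1..k}}"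
    then have \<sigma>: "\<sigma> permutes {1..k}" by simp
    show \<sigma>_eq: "?m (?m' \<sigma>) = \<sigma>"
      by (rule map_permutation_compose_inv[OF bij' \<sigma>]) auto
    show p: "?m' \<sigma> \<in> {p. p permutes {0..<k}}"
      using map_permutation_permutes[OF bij' \<sigma>] by simp
    have "(\<Prod>a=1..k. f a (\<sigma> a)) = (\<Prod>i=0..<k. f (Suc i) (\<sigma> (Suc i)))"
      by (rule prod.reindex_bij_betw[OF bij, symmetric])
    also have "\<dots> = (\<Prod>i=0..<k. f (Suc i) (Suc (?m' \<sigma> i)))"
    proof (rule prod.cong[OF refl])
      fix i assume i: "i \<in> {0..<k}"
      then have "\<sigma> (Suc i) = Suc (?m' \<sigma> i)"
        by (subst \<sigma>_eq[symmetric], subst map_permutation_apply) auto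
      then show "f (Suc i) (\<sigma> (Suc i)) = f (Suc i) (Suc (?m' \<sigma> i))" by simp
    qed
    finally show "of_int (sign (?m' \<sigma>)) * (\<Prod>i=0..<k. f (Suc i) (Suc (?m' \<sigma> i))) =
        of_int (sign \<sigma>) * (\<Prod>a=1..k. f a (\<sigma> a))"
      using sign_map_permutation[OF bij_betw_imp_inj_on[OF bij'] \<sigma>] by simp
  next
    fix p assume "p \<in> {p. p permutes {0..<k}}"
    then have p: "p permutes {0..<k}" by simp
    show "?m' (?m p) = p"
      by (rule map_permutation_compose_inv[OF bij p]) auto
    show "?m p \<in> {\<sigma>. \<sigma> permutes {1..k}}"
      using map_permutation_permutes[OF bij p] by simp
  qed
  then show ?thesis
    unfolding det_def'[OF mat_carrier] by (auto intro!: sum.cong prod.cong)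
qed

text \<open>The elements increase strictly, starting from at least 1. This makes the subtraction
  \<open>elt I a - a\<close> exact in the degree count.\<close>

lemma elt_ge:
  assumes "I \<subseteq> {1..n}" "card I = k" "a \<in> {1..k}"
  shows "a \<le> elt I a"
proof -
  have fin: "finite I" using assms(1) finite_subset by blast
  let ?l = "sorted_list_of_set I"
  have len: "length ?l = k" using assms by simp
  have "Suc i \<le> ?l ! i" if "i < k" for i
    using that
  proof (induction i)
    case 0
    then have "?l ! 0 \<in> I" using fin len nth_mem[of 0 ?l] by simp
    then show ?case using assms(1) by auto
  next
    case (Suc i)
    have "?l ! i < ?l ! Suc i"
      using sorted_wrt_nth_less[OF strict_sorted_list_of_set] Suc.prems len by auto
    then show ?case using Suc by simp
  qed
  from this[of "a - 1"] show ?thesis using assms(3) by (auto simp: elt_def)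
qed

text \<open>Monomials of different degrees are distinct, so the polynomial ring is infinite even
  over a finite coefficient ring.\<close>

lemma infinite_UNIV_poly: "infinite (UNIV :: 'a::comm_semiring_1 poly set)"
proof -
  have "inj (\<lambda>i. monom (1 :: 'a) i)"
    by (rule injI) (metis degree_monom_eq zero_neq_one)
  then show ?thesis by (metis infinite_UNIV_nat finite_imageD finite_subset subset_UNIV)
qed

text \<open>As polynomials in h, the factors containing h are monic of degree 1: for each
  \<open>a\<close> there is h itself, then \<open>i a - 1\<close> factors, then \<open>k - a\<close>
  factors. The product in the middle is free of h, so it alone survives in the top coefficient; it
  accounts for the \<open>0\<close> in \<open>d\<close>.\<close>

lemma weight_numerator_coeff:
  fixes y z :: "nat \<Rightarrow> 'r::comm_ring_1" and i :: "nat \<Rightarrow> nat" and n k :: nat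
  defines "w \<equiv> \<Prod>a=1..k. [:0, 1:] * ((\<Prod>u=1..i a - 1. [:y a:] - [:z u:] + [:0, 1:]) *
      (\<Prod>u=i a + 1..n. [:y a:] - [:z u:]) * (\<Prod>b=a+1..k. [:y a:] - [:y b:] + [:0, 1:]))"
    and "d \<equiv> \<Sum>a=1..k. 1 + ((i a - 1) + 0 + (k - a))"
  shows "degree w \<le> d" "coeff w d = (\<Prod>a=1..k. \<Prod>u=i a + 1..n. y a - z u)"
proof -
  let ?A = "\<lambda>a. \<Prod>u=1..i a - 1. [:y a:] - [:z u:] + [:0, 1:]"
  let ?B = "\<lambda>a. \<Prod>u=i a + 1..n. [:y a:] - [:z u:]"
  let ?C = "\<lambda>a. \<Prod>b=a+1..k. [:y a:] - [:y b:] + [:0, 1:]"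
  have A: "degree (?A a) \<le> i a - 1 \<and> coeff (?A a) (i a - 1) = 1" for a
    using coeff_prod_degree_le[of "{1..i a - 1}" "\<lambda>u. [:y a:] - [:z u:] + [:0, 1:]" "\<lambda>_. 1"]
    by simp
  have B: "degree (?B a) \<le> 0 \<and> coeff (?B a) 0 = (\<Prod>u=i a + 1..n. y a - z u)" for a
    using coeff_prod_degree_le[of "{i a + 1..n}" "\<lambda>u. [:y a:] - [:z u:]" "\<lambda>_. 0"]
    by simp
  have C: "degree (?C a) \<le> k - a \<and> coeff (?C a) (k - a) = 1" for a
    using coeff_prod_degree_le[of "{a+1..k}" "\<lambda>b. [:y a:] - [:y b:] + [:0, 1:]" "\<lambda>_. 1"]
    by simp
  have H: "degree [:0, 1 :: 'r:] \<le> 1" "coeff [:0, 1 :: 'r:] 1 = 1" by simp_all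
  have "degree ([:0, 1:] * (?A a * ?B a * ?C a)) \<le> 1 + ((i a - 1) + 0 + (k - a)) \<and>
      coeff ([:0, 1:] * (?A a * ?B a * ?C a)) (1 + ((i a - 1) + 0 + (k - a))) =
        (\<Prod>u=i a + 1..n. y a - z u)" for a
  proof -
    have AB: "degree (?A a * ?B a) \<le> i a - 1 + 0"
        "coeff (?A a * ?B a) (i a - 1 + 0) = (\<Prod>u=i a + 1..n. y a - z u)"
      using coeff_mult_degree_le[of "?A a" "i a - 1" "?B a" 0] A[of a] B[of a] by auto
    have ABC: "degree (?A a * ?B a * ?C a) \<le> i a - 1 + 0 + (k - a)"
        "coeff (?A a * ?B a * ?C a) (i a - 1 + 0 + (k - a)) = (\<Prod>u=i a + 1..n. y a - z u)"
      using coeff_mult_degree_le[OF AB(1), of "?C a" "k - a"] AB C[of a] by auto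
    show ?thesis
      using coeff_mult_degree_le[OF H(1) ABC(1)] ABC H(2) by (simp del: mult_pCons_left)
  qed
  note factor = this
  show "degree w \<le> d" "coeff w d = (\<Prod>a=1..k. \<Prod>u=i a + 1..n. y a - z u)"
    using coeff_prod_degree_le[of "{1..k}" "\<lambda>a. [:0, 1:] * (?A a * ?B a * ?C a)"
        "\<lambda>a. 1 + ((i a - 1) + 0 + (k - a))"] factor
    unfolding w_def[symmetric] d_def[symmetric] by (simp_all only: finite_atLeastAtMost)
qed

section \<open>Specialization to the variables and comparison of top coefficients\<close>

lemma vandermonde_neq_0:
  fixes x :: "nat \<Rightarrow> 'a::idom"
  assumes "inj x"
  shows "vandermonde k x \<noteq> 0"
  using inj_eq[OF assms] by (auto simp: vandermonde_pairs)

theorem proposition5p4: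
  fixes n k :: nat and I :: "nat set"
  assumes "1 \<le> k" and "k \<le> n" and "I \<subseteq> {1..n}" and "card I = k"
  shows "\<exists>(W :: 'a::idom tzpoly poly) (\<Delta> :: 'a tzpoly).
      to_fract W = weight_function n k I \<and>
      to_fract [:\<Delta>:] = double_schur n k I \<and>
      degree (W - monom (sgnI n k I * \<Delta>) (k\<^sup>2 + ell k I)) < k\<^sup>2 + ell k I"
proof -
  define y :: "nat \<Rightarrow> 'a tzpoly" where "y a = Poly_Mapping.single (Poly_Mapping.single a 1) 1" for a
  define z :: "nat \<Rightarrow> 'a tzpoly" where
    "z u = Poly_Mapping.single 0 (Poly_Mapping.single (Poly_Mapping.single u 1) 1)" for u
  define x where "x a = [:y a:]" for a
  \<comment> \<open>The summand of \<open>W_I\<close> without its denominator, where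
    \<open>h^k\<close> is distributed as one factor h for each \<open>a\<close>. Below,
    \<open>N\<close> is the numerator of \<open>W_I\<close> over the common denominator, and
    \<open>D\<close> the Leibniz expansion of the determinant.\<close>
  define F :: "(nat \<Rightarrow> 'a tzpoly poly) \<Rightarrow> 'a tzpoly poly" where
    "F t = (\<Prod>a=1..k. [:0, 1:] * ((\<Prod>u=1..elt I a - 1. t a - [:z u:] + [:0, 1:]) *
      (\<Prod>u=elt I a + 1..n. t a - [:z u:]) * (\<Prod>b=a+1..k. t a - t b + [:0, 1:])))" for t
  define N where "N = (\<Sum>\<sigma> | \<sigma> permutes {1..k}. of_int (sign \<sigma>) * F (x \<circ> \<sigma>))"
  define D where "D = (\<Sum>\<sigma> | \<sigma> permutes {1..k}. of_int (sign \<sigma>) *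
      (\<Prod>a=1..k. \<Prod>u=elt I a + 1..n. y (\<sigma> a) - z u))"
  define d where "d = k\<^sup>2 + ell k I"
  let ?V = "vandermonde k"
  have tvar: "tvar = to_fract \<circ> x" and zvar: "zvar u = to_fract [:z u:]" for u
    by (auto simp: fun_eq_iff tvar_def zvar_def x_def y_def z_def)
  have "inj y"
    by (rule injI) (auto simp: y_def dest!: arg_cong[where f = "\<lambda>p. Poly_Mapping.keys p"])
  then have inj_x: "inj x" by (auto simp: inj_def x_def)
  have Vy: "?V y \<noteq> 0" and Vx: "?V x \<noteq> 0"
    by (rule vandermonde_neq_0[OF \<open>inj y\<close>], rule vandermonde_neq_0[OF inj_x])
  have Vx_y: "?V x = [:?V y:]"
    by (simp add: vandermonde_def x_def prod_to_poly)

  \<comment> \<open>Here h and the \<open>z u\<close> are constants; only the t-variables vary, over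
    the infinite domain \<open>'a tzpoly poly\<close>.\<close>
  have "polyfun F"
    unfolding F_def by (intro polyfun_prod polyfun_diff polyfun.intros)
  then obtain G where G: "\<And>t. (\<Sum>\<sigma> | \<sigma> permutes {1..k}. of_int (sign \<sigma>) * F (t \<circ> \<sigma>)) = ?V t * G t"
    using alternating_sum_factor[OF infinite_UNIV_poly] by blast
  define W where "W = G x"
  have N: "N = [:?V y:] * W"
    unfolding N_def W_def G Vx_y ..

  \<comment> \<open>Since 1 <= a <= i_a, the exponents 1, i_a - 1 and k - a add up to k + (i_a - a);
    summing over the k indices gives k^2 + ell.\<close>
  have d: "(\<Sum>a=1..k. 1 + ((elt I a - 1) + 0 + (k - a))) = d"
  proof -
    have "(\<Sum>a=1..k. 1 + ((elt I a - 1) + 0 + (k - a))) = (\<Sum>a=1..k. k + (elt I a - a))"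
    proof (rule sum.cong[OF refl])
      fix a assume "a \<in> {1..k}"
      with elt_ge[OF assms(3,4) this] show "1 + ((elt I a - 1) + 0 + (k - a)) = k + (elt I a - a)"
        by auto
    qed
    then show ?thesis by (simp add: d_def ell_def sum.distrib power2_eq_square)
  qed
  have F: "degree (F (x \<circ> \<sigma>)) \<le> d"
      "coeff (F (x \<circ> \<sigma>)) d = (\<Prod>a=1..k. \<Prod>u=elt I a + 1..n. y (\<sigma> a) - z u)" for \<sigma>
    using weight_numerator_coeff[where y = "y \<circ> \<sigma>" and z = z and n = n and k = k and i = "elt I"]
    unfolding d F_def x_def o_def by auto
  have of_int: "of_int m * p = smult (of_int m) p" for m and p :: "'a tzpoly poly"
    by (simp add: of_int_poly)
  have "degree N \<le> d"
    unfolding N_def of_int using F(1)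
    by (intro degree_sum_le finite_permutations) (auto intro: order.trans[OF degree_smult_le])
  \<comment> \<open>The Vandermonde product is a nonzero constant with respect to h, so dividing by
    it leaves the degree unchanged and divides each coefficient by it.\<close>
  then have "degree W \<le> d"
    using Vy by (simp add: N)
  have "coeff N d = D"
    unfolding N_def D_def of_int by (simp add: coeff_sum F(2))
  then have D: "?V y * coeff W d = D"
    by (simp add: N)

  have W: "to_fract W = weight_function n k I"
  proof -
    define w where "w t = (\<Prod>a=1..k. (\<Prod>u=1..elt I a - 1. t a - zvar u + hvar) *
        (\<Prod>u=elt I a + 1..n. t a - zvar u) *
        (\<Prod>b=a+1..k. (t a - t b + hvar) / (t a - t b)))" for t :: "nat \<Rightarrow> 'a ratfun"
    have w: "hvar ^ k * w (to_fract \<circ> t) = to_fract (F t) / to_fract (?V t)" for t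
    proof -
      have "hvar ^ k = (\<Prod>a=1..k. hvar :: 'a ratfun)" by simp
      then show ?thesis
        unfolding w_def F_def vandermonde_def
        by (simp only: to_fract_prod to_fract_mult to_fract_add to_fract_diff zvar hvar_def
            prod_dividef prod.distrib[symmetric] o_def times_divide_eq_right)
    qed
    \<comment> \<open>Permuting the variables multiplies the common denominator by the sign of the
      permutation; being 1 or -1, it may be moved to the numerator.\<close>
    have "hvar ^ k * w (to_fract \<circ> x \<circ> \<sigma>) = to_fract (of_int (sign \<sigma>) * F (x \<circ> \<sigma>)) / to_fract (?V x)"
      if "\<sigma> permutes {1..k}" for \<sigma>
      using w[of "x \<circ> \<sigma>"] unfolding vandermonde_permute[OF that]
      by (cases \<sigma> rule: sign_cases) (simp_all add: o_assoc)
    then have "hvar ^ k * (\<Sum>\<sigma> | \<sigma> permutes {1..k}. w (to_fract \<circ> x \<circ> \<sigma>)) = to_fract N / to_fract (?V x)"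
      by (simp add: N_def sum_distrib_left sum_divide_distrib del: to_fract_mult)
    also have "\<dots> = to_fract W"
      using Vx by (simp add: N flip: Vx_y)
    finally show ?thesis
      unfolding weight_function_def Sym_def w_def tvar o_def by simp
  qed

  \<comment> \<open>By \<open>D\<close>, the coefficient of \<open>W\<close> is the determinant
    already divided by the Vandermonde product, so only the sign is missing.\<close>
  define \<Delta> where "\<Delta> = sgnI n k I * coeff W d"
  have "det (mat k k (\<lambda>(\<alpha>, \<beta>). \<Prod>u=elt I (\<alpha> + 1) + 1..n. tvar (\<beta> + 1) - zvar u)) = to_fract [:D:]"
  proof -
    have "[:D:] = (\<Sum>\<sigma> | \<sigma> permutes {1..k}. of_int (sign \<sigma>) *
        (\<Prod>a=1..k. \<Prod>u=elt I a + 1..n. x (\<sigma> a) - [:z u:]))"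
      unfolding of_int D_def x_def by (simp add: prod_to_poly sum_to_poly)
    then show ?thesis
      unfolding det_mat_Suc[where f = "\<lambda>a b. \<Prod>u=elt I a + 1..n. tvar b - zvar u"]
      by (simp add: to_fract_prod to_fract_of_int tvar zvar)
  qed
  moreover have "to_fract [:\<Delta>:] = (-1) ^ (k * (n - k) - ell k I) * to_fract [:coeff W d:]"
    by (cases "even (k * (n - k) - ell k I)") (simp_all add: \<Delta>_def sgnI_def flip: to_fract_uminus)
  moreover have "to_fract [:D:] = to_fract (?V x) * to_fract [:coeff W d:]"
    by (simp add: Vx_y mult_to_poly flip: D to_fract_mult)
  moreover have V: "(\<Prod>a=1..k. \<Prod>b=a+1..k. tvar a - tvar b) = to_fract (?V x)"
    by (simp add: vandermonde_def to_fract_prod tvar)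
  ultimately have \<Delta>: "to_fract [:\<Delta>:] = double_schur n k I"
    using Vx unfolding double_schur_def V by simp

  \<comment> \<open>The sign squares to 1.\<close>
  have "sgnI n k I * \<Delta> = coeff W d"
    by (simp add: \<Delta>_def sgnI_def flip: mult.assoc power_add)
  then have "coeff (W - monom (sgnI n k I * \<Delta>) d) d = 0" by simp
  moreover have "degree (W - monom (sgnI n k I * \<Delta>) d) \<le> d"
    using \<open>degree W \<le> d\<close> by (intro degree_diff_le degree_monom_le)
  \<comment> \<open>The zero polynomial has degree 0, so a vanishing coefficient at \<open>d\<close>
    makes the bound strict only for positive \<open>d\<close>.\<close>
  moreover have "0 < d" using assms(1) by (simp add: d_def)
  ultimately have "degree (W - monom (sgnI n k I * \<Delta>) d) < d"
    by (metis degree_0 le_neq_implies_less leading_coeff_0_iff)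
  with W \<Delta> show ?thesis unfolding d_def by blast
qed

end
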